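(* Let $N$ be a finite set of positive integers and let $\sigma$ be a partition of $N$ (into nonempty pairwise disjoint blocks). Then the set of intervals of the form $$\Big[\bigvee\{\kappa_S \mid S\in\sigma\},\ \times\{\kappa_S\mid S\in\sigma\}\Big],$$ where $\{\kappa_S\mid S\in\sigma\}$ ranges over all families of antimonotonic functions satisfying $\kappa_S\in\Upsilon_S$ for all $S\in\sigma$, forms a partition of $\Upsilon_N$.
   Context: For a finite set $N$ of positive integers, an antimonotonic function on $2^N$ is a boolean function on $2^N$, identified with the set $\alpha$ of subsets of $N$ on which it is true, such that no element of $\alpha$ is a proper subset of another element of $\alpha$. $AMT(N)$ is the set of all of them (both $\emptyset$ and $\{\emptyset\}$ belong to it). Order: $\alpha\le\beta$ iff every $A\in\alpha$ is contained in some $B\in\beta$. The interval $[\alpha,\beta]$ is $\{\kappa\in AMT(N): \alpha\le\kappa\le\beta\}$ (empty if $\alpha\not\le\beta$). For a family $\mathcal{S}$ of sets, $\sup(\mathcal{S})$ is the set of inclusion-maximal members of $\mathcal{S}$. The span is $sp(\alpha)=\bigcup_{A\in\alpha}A$. Join: $\alpha\vee\beta=\sup(\alpha\cup\beta)$. External product: $\alpha\times\beta=\sup\{(A\setminus sp(\beta))\cup(B\setminus sp(\alpha))\cup(A\cap B)\mid A\in\alpha,\,B\in\beta\}$; for $\alpha,\beta\neq\emptyset$ this is the largest $\kappa\in AMT(N)$ with $sp(\kappa)=sp(\alpha)\cup sp(\beta)$, $\sup\{K\cap sp(\alpha)\mid K\in\kappa\}\le\alpha$ and $\sup\{K\cap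 sp(\beta)\mid K\in\kappa\}\le\beta$. Both operations are associative and commutative; $\bigvee\{\alpha_1,\dots,\alpha_k\}=\alpha_1\vee\dots\vee\alpha_k$ and $\times\{\alpha_1,\dots,\alpha_k\}=\alpha_1\times\dots\times\alpha_k$ (indexed families). By convention both operations applied to an empty family give $\{\emptyset\}$. For a finite set $M$ of positive integers, $\Upsilon_M=[\alpha_M,\omega_M]$ with $\alpha_M=\bigvee\{\{\{x\}\}\mid x\in M\}$ and $\omega_M=\{M\}$; so $\Upsilon_\emptyset=\{\{\emptyset\}\}$, and for $M\ne\emptyset$, $\alpha_M=\{\{x\}\mid x\in M\}$ and $\Upsilon_M$ is the set of antimonotonic functions with span $M$. *)

theory Defs
  imports Main "HOL-Library.Disjoint_Sets"
begin

text \<open>A boolean function on the power set of \<open>N\<close> is represented by the set of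
  subsets of \<open>N\<close> on which it is true.\<close>

definition AMT :: "nat set \<Rightarrow> nat set set set" where
  "AMT N = {\<alpha>. \<alpha> \<subseteq> Pow N \<and> (\<forall>A\<in>\<alpha>. \<forall>B\<in>\<alpha>. \<not> A \<subset> B)}"

definition amt_le :: "nat set set \<Rightarrow> nat set set \<Rightarrow> bool" where
  "amt_le \<alpha> \<beta> \<longleftrightarrow> (\<forall>A\<in>\<alpha>. \<exists>B\<in>\<beta>. A \<subseteq> B)"

definition amt_interval :: "nat set \<Rightarrow> nat set set \<Rightarrow> nat set set \<Rightarrow> nat set set set" where
  "amt_interval N \<alpha> \<beta> = {\<kappa> \<in> AMT N. amt_le \<alpha> \<kappa> \<and> amt_le \<kappa> \<beta>}"

definition max_sets :: "nat set set \<Rightarrow> nat set set" where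
  "max_sets \<S> = {A \<in> \<S>. \<not> (\<exists>B\<in>\<S>. A \<subset> B)}"

definition sp :: "nat set set \<Rightarrow> nat set" where
  "sp \<alpha> = \<Union>\<alpha>"

definition amt_join :: "nat set set \<Rightarrow> nat set set \<Rightarrow> nat set set" where
  "amt_join \<alpha> \<beta> = max_sets (\<alpha> \<union> \<beta>)"

definition ext_prod :: "nat set set \<Rightarrow> nat set set \<Rightarrow> nat set set" where
  "ext_prod \<alpha> \<beta> = max_sets {(A - sp \<beta>) \<union> (B - sp \<alpha>) \<union> (A \<inter> B) | A B. A \<in> \<alpha> \<and> B \<in> \<beta>}"

text \<open>The iteration of a binary operation over a family \<open>\<kappa>\<close> indexed by a finite set \<open>I\<close>,
  equal to \<open>{{}}\<close> for the empty family. The accumulator \<open>None\<close> stands for ``no member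
  yet'', so that for nonempty \<open>I\<close> the value \<open>{{}}\<close> does not enter the computation: it is
  not neutral for the join, since joining it with \<open>{}\<close> gives \<open>{{}}\<close>.\<close>

definition amt_iter ::
  "(nat set set \<Rightarrow> nat set set \<Rightarrow> nat set set) \<Rightarrow> ('i \<Rightarrow> nat set set) \<Rightarrow> 'i set \<Rightarrow> nat set set" where
  "amt_iter f \<kappa> I =
     (case Finite_Set.fold (\<lambda>i y. Some (case y of None \<Rightarrow> \<kappa> i | Some z \<Rightarrow> f (\<kappa> i) z)) None I of
        None \<Rightarrow> {{}} | Some r \<Rightarrow> r)"

definition amt_Join :: "('i \<Rightarrow> nat set set) \<Rightarrow> 'i set \<Rightarrow> nat set set" where
  "amt_Join = amt_iter amt_join"

definition ext_Prod :: "('i \<Rightarrow> nat set set) \<Rightarrow> 'i set \<Rightarrow> nat set set" where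
  "ext_Prod = amt_iter ext_prod"

definition alpha :: "nat set \<Rightarrow> nat set set" where
  "alpha M = amt_Join (\<lambda>x. {{x}}) M"

definition omega :: "nat set \<Rightarrow> nat set set" where
  "omega M = {M}"

text \<open>Members of an interval with upper end \<open>omega M\<close> consist of subsets of \<open>M\<close>, so any
  ambient set containing \<open>M\<close> gives the same interval (lemma \<open>Upsilon_ambient\<close>).\<close>

definition Upsilon :: "nat set \<Rightarrow> nat set set set" where
  "Upsilon M = amt_interval M (alpha M) (omega M)"

lemma Upsilon_ambient:
  assumes "M \<subseteq> N"
  shows "amt_interval N (alpha M) (omega M) = Upsilon M"
proof -
  have "\<kappa> \<in> AMT N \<and> amt_le \<kappa> {M} \<longleftrightarrow> \<kappa> \<in> AMT M \<and> amt_le \<kappa> {M}" for \<kappa>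
  proof -
    have "\<kappa> \<subseteq> Pow N \<and> amt_le \<kappa> {M} \<longleftrightarrow> \<kappa> \<subseteq> Pow M \<and> amt_le \<kappa> {M}"
      using assms unfolding amt_le_def subset_iff Pow_iff by simp blast
    then show ?thesis
      unfolding AMT_def mem_Collect_eq by argo
  qed
  then show ?thesis
    unfolding Upsilon_def amt_interval_def omega_def by meson
qed

lemma amt_iter_empty: "amt_iter f \<kappa> {} = {{}}"
  by (simp add: amt_iter_def)

lemma amt_iter_eqI:
  assumes "finite I" "I \<noteq> {}"
    and sing: "\<And>i. i \<in> I \<Longrightarrow> P {i} (\<kappa> i)"
    and step: "\<And>i J z. i \<in> I \<Longrightarrow> J \<subseteq> I \<Longrightarrow> J \<noteq> {} \<Longrightarrow> i \<notin> J \<Longrightarrow> P J z \<Longrightarrow> P (insert i J) (f (\<kappa> i) z)"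
    and unique: "\<And>z. P I z \<Longrightarrow> z = r"
  shows "amt_iter f \<kappa> I = r"
proof -
  let ?g = "\<lambda>i y. Some (case y of None \<Rightarrow> \<kappa> i | Some z \<Rightarrow> f (\<kappa> i) z)"
  have inv: "J \<subseteq> I \<longrightarrow> (J = {} \<and> y = None) \<or> (J \<noteq> {} \<and> (\<exists>z. y = Some z \<and> P J z))"
    if "fold_graph ?g None J y" for J y
    using that
  proof (induction rule: fold_graph.induct)
    case emptyI
    then show ?case by simp
  next
    case (insertI i J y)
    show ?case
    proof (cases "J = {}")
      case True
      then show ?thesis using insertI.IH sing by simp
    next
      case False
      show ?thesis
      proof
        assume sub: "insert i J \<subseteq> I"
        then obtain z where z: "y = Some z" "P J z"
          using insertI.IH False by blast
        have "P (insert i J) (f (\<kappa> i) z)"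
          using step[OF _ _ False insertI.hyps(1) z(2)] sub by simp
        then show "(insert i J = {} \<and> ?g i y = None) \<or>
            (insert i J \<noteq> {} \<and> (\<exists>z. ?g i y = Some z \<and> P (insert i J) z))"
          using z(1) by simp
      qed
    qed
  qed
  have only: "y = Some r" if y: "fold_graph ?g None I y" for y
  proof -
    obtain z where "y = Some z" "P I z"
      using inv[OF y] assms(2) by auto
    then show ?thesis
      using unique by simp
  qed
  obtain y where "fold_graph ?g None I y"
    using finite_imp_fold_graph[OF assms(1)] ..
  then have "fold_graph ?g None I (Some r)"
    using only by metis
  then have "(THE y. fold_graph ?g None I y) = Some r"
    using only by (rule the_equality)
  then have "Finite_Set.fold ?g None I = Some r"
    using assms(1) by (simp only: Finite_Set.fold_def if_True)
  then show ?thesis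
    by (simp add: amt_iter_def)
qed

lemma alpha_empty: "alpha {} = {{}}"
  by (simp add: alpha_def amt_Join_def amt_iter_empty)

lemma alpha_nonempty:
  assumes "finite M" "M \<noteq> {}"
  shows "alpha M = {{x} | x. x \<in> M}"
  unfolding alpha_def amt_Join_def
proof (rule amt_iter_eqI[where P = "\<lambda>J z. z = {{x} | x. x \<in> J}"])
  fix i J and z :: "nat set set"
  assume "z = {{x} | x. x \<in> J}"
  then have "{{i}} \<union> z = {{x} | x. x \<in> insert i J}"
    by blast
  moreover have "max_sets {{x} | x. x \<in> K} = {{x} | x. x \<in> K}" for K
    unfolding max_sets_def by blast
  ultimately show "amt_join {{i}} z = {{x} | x. x \<in> insert i J}"
    by (simp only: amt_join_def)
qed (use assms in \<open>simp_all\<close>)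

lemma Upsilon_empty: "Upsilon {} = {{{}}}"
proof -
  have "\<kappa> \<in> Upsilon {} \<longleftrightarrow> \<kappa> = {{}}" for \<kappa>
    by (simp add: Upsilon_def amt_interval_def AMT_def amt_le_def omega_def alpha_empty) blast
  then show ?thesis
    by blast
qed

lemma Upsilon_nonempty:
  assumes "finite M" "M \<noteq> {}"
  shows "Upsilon M = {\<kappa> \<in> AMT M. sp \<kappa> = M}"
proof -
  have "amt_le (alpha M) \<kappa> \<and> amt_le \<kappa> (omega M) \<longleftrightarrow> sp \<kappa> = M" for \<kappa>
  proof -
    have "amt_le (alpha M) \<kappa> \<longleftrightarrow> M \<subseteq> sp \<kappa>"
      by (simp add: alpha_nonempty[OF assms] amt_le_def sp_def subset_iff Bex_def) blast
    moreover have "amt_le \<kappa> (omega M) \<longleftrightarrow> sp \<kappa> \<subseteq> M"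
      by (simp add: amt_le_def omega_def sp_def Sup_le_iff)
    ultimately show ?thesis
      by blast
  qed
  then show ?thesis
    by (simp add: Upsilon_def amt_interval_def)
qed

end

theory Submission imports Defs begin

text \<open>
  An antimonotonic function on a finite set is determined by the sets lying below its members, so
  the order is a partial order on antimonotonic functions, and a finite family \<open>\<F>\<close> may be replaced
  by \<open>max_sets \<F>\<close> on either side of it.

  For a nonempty family of disjoint nonempty blocks \<open>S\<close> the two ends of an interval have simple closed forms. The join of
  the \<open>\<kappa> S\<close> is their plain union, because members over different blocks are disjoint and nonempty,
  hence incomparable (\<open>amt_Join_blocks\<close>). The external product consists of the sets whose trace on
  each block \<open>S\<close> is a member of \<open>\<kappa> S\<close> (\<open>ext_Prod_blocks\<close>). Therefore \<open>\<chi>\<close> lies above the join iff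
  every \<open>\<kappa> S\<close> lies below the family of traces of \<open>\<chi>\<close> on \<open>S\<close>, and below the product iff that family
  of traces lies below \<open>\<kappa> S\<close>. By antisymmetry the interval of \<open>\<kappa>\<close> is
  exactly the fibre over \<open>\<kappa>\<close> of the map that sends \<open>\<chi>\<close> to its maximal traces on the blocks
  (\<open>amt_interval_blocks_iff\<close>). Fibres of a map partition its domain; what remains is that the map
  sends \<open>Upsilon N\<close> into the product of the \<open>Upsilon S\<close> (\<open>max_traces_in_Upsilon\<close>), that fibres
  stay inside \<open>Upsilon N\<close>, and that no fibre is empty, the union of the \<open>\<kappa> S\<close> being a witness.
\<close>

section \<open>The order on finite families of sets\<close>

definition traces :: "nat set \<Rightarrow> nat set set \<Rightarrow> nat set set" where
  "traces S \<chi> = (\<lambda>X. X \<inter> S) ` \<chi>"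

lemma AMT_I:
  "(\<And>A. A \<in> \<alpha> \<Longrightarrow> A \<subseteq> N) \<Longrightarrow> (\<And>A B. A \<in> \<alpha> \<Longrightarrow> B \<in> \<alpha> \<Longrightarrow> A \<subseteq> B \<Longrightarrow> A = B) \<Longrightarrow> \<alpha> \<in> AMT N"
  unfolding AMT_def psubset_eq by blast

lemma AMT_subsetD: "\<alpha> \<in> AMT N \<Longrightarrow> A \<in> \<alpha> \<Longrightarrow> A \<subseteq> N"
  unfolding AMT_def by blast

lemma AMT_antichainD: "\<alpha> \<in> AMT N \<Longrightarrow> A \<in> \<alpha> \<Longrightarrow> B \<in> \<alpha> \<Longrightarrow> A \<subseteq> B \<Longrightarrow> A = B"
  unfolding AMT_def by (simp add: psubset_eq)

lemma AMT_mono: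
  assumes "\<alpha> \<in> AMT N" "\<beta> \<subseteq> \<alpha>"
  shows "\<beta> \<in> AMT N"
proof (rule AMT_I)
  show "A \<subseteq> N" if "A \<in> \<beta>" for A
    using AMT_subsetD[OF assms(1)] assms(2) that by blast
  show "A = B" if "A \<in> \<beta>" "B \<in> \<beta>" "A \<subseteq> B" for A B
    using AMT_antichainD[OF assms(1) subsetD[OF assms(2) that(1)] subsetD[OF assms(2) that(2)] that(3)] .
qed

lemma finite_AMT: "finite N \<Longrightarrow> \<alpha> \<in> AMT N \<Longrightarrow> finite \<alpha>"
  unfolding AMT_def by (auto intro: finite_subset)

lemma amt_le_trans: "amt_le \<alpha> \<beta> \<Longrightarrow> amt_le \<beta> \<gamma> \<Longrightarrow> amt_le \<alpha> \<gamma>"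
  unfolding amt_le_def by (meson order_trans)

lemma amt_le_refl: "amt_le \<alpha> \<alpha>"
  unfolding amt_le_def by blast

text \<open>A member \<open>A\<close> of \<open>\<alpha>\<close> is squeezed as \<open>A \<subseteq> B \<subseteq> A'\<close> with \<open>B \<in> \<beta>\<close> and \<open>A' \<in> \<alpha>\<close>; since \<open>\<alpha>\<close> is an
  antichain, \<open>A = A' = B\<close>.\<close>

lemma amt_le_antisym:
  assumes "\<alpha> \<in> AMT N" "\<beta> \<in> AMT N" "amt_le \<alpha> \<beta>" "amt_le \<beta> \<alpha>"
  shows "\<alpha> = \<beta>"
proof -
  have "\<alpha> \<subseteq> \<beta>" if le: "\<alpha> \<in> AMT N" "amt_le \<alpha> \<beta>" "amt_le \<beta> \<alpha>" for \<alpha> \<beta>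
  proof
    fix A assume A: "A \<in> \<alpha>"
    obtain B where B: "B \<in> \<beta>" "A \<subseteq> B" using le(2) A unfolding amt_le_def by blast
    obtain A' where A': "A' \<in> \<alpha>" "B \<subseteq> A'" using le(3) B unfolding amt_le_def by blast
    have "A = A'" using AMT_antichainD[OF le(1) A A'(1)] B(2) A'(2) by blast
    then show "A \<in> \<beta>" using B A' by auto
  qed
  then show ?thesis using assms by blast
qed

lemma amt_le_max_sets_self:
  assumes "finite \<F>"
  shows "amt_le \<F> (max_sets \<F>)"
  unfolding amt_le_def
proof
  fix A assume "A \<in> \<F>"
  then obtain B where B: "B \<in> \<F>" "A \<subseteq> B" "\<forall>C\<in>\<F>. B \<subseteq> C \<longrightarrow> B = C"
    using finite_has_maximal2[OF assms] by metis
  then have "B \<in> max_sets \<F>" unfolding max_sets_def by blast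
  then show "\<exists>B\<in>max_sets \<F>. A \<subseteq> B" using B(2) by blast
qed

lemma max_sets_amt_le_self: "amt_le (max_sets \<F>) \<F>"
  unfolding amt_le_def max_sets_def by blast

lemma amt_le_max_sets_iff: "finite \<G> \<Longrightarrow> amt_le \<F> (max_sets \<G>) \<longleftrightarrow> amt_le \<F> \<G>"
  by (meson amt_le_trans amt_le_max_sets_self max_sets_amt_le_self)

lemma max_sets_amt_le_iff: "finite \<F> \<Longrightarrow> amt_le (max_sets \<F>) \<G> \<longleftrightarrow> amt_le \<F> \<G>"
  by (meson amt_le_trans amt_le_max_sets_self max_sets_amt_le_self)

lemma max_sets_in_AMT: "\<F> \<subseteq> Pow N \<Longrightarrow> max_sets \<F> \<in> AMT N"
  unfolding AMT_def max_sets_def by blast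

lemma max_sets_antichain: "\<alpha> \<in> AMT N \<Longrightarrow> max_sets \<alpha> = \<alpha>"
  unfolding AMT_def max_sets_def by blast

lemma sp_max_sets:
  assumes "finite \<F>"
  shows "sp (max_sets \<F>) = sp \<F>"
  using amt_le_max_sets_self[OF assms] max_sets_amt_le_self[of \<F>]
  unfolding amt_le_def sp_def by blast

text \<open>The empty set is comparable with every set, so an antichain containing it has no other
  member and empty span.\<close>

lemma empty_notin_Upsilon:
  assumes "finite M" "M \<noteq> {}" "\<alpha> \<in> Upsilon M"
  shows "{} \<notin> \<alpha>"
proof
  assume "{} \<in> \<alpha>"
  then have "\<forall>A\<in>\<alpha>. A = {}"
    using assms unfolding Upsilon_nonempty[OF assms(1,2)] AMT_def by blast
  then show False
    using assms unfolding Upsilon_nonempty[OF assms(1,2)] sp_def by blast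
qed

lemma max_traces_in_Upsilon:
  assumes "finite N" "\<chi> \<in> AMT N" "S \<subseteq> sp \<chi>" "finite S" "S \<noteq> {}"
  shows "max_sets (traces S \<chi>) \<in> Upsilon S"
proof -
  have "finite (traces S \<chi>)"
    using finite_AMT[OF assms(1,2)] by (simp add: traces_def)
  then have "sp (max_sets (traces S \<chi>)) = S"
    using assms(3) by (simp add: sp_max_sets) (auto simp: sp_def traces_def)
  moreover have "max_sets (traces S \<chi>) \<in> AMT S"
    by (rule max_sets_in_AMT) (auto simp: traces_def)
  ultimately show ?thesis
    using Upsilon_nonempty[OF assms(4,5)] by blast
qed

section \<open>Join and external product over disjoint blocks\<close>

text \<open>Here the \<open>\<kappa> S\<close> live on disjoint sets and have no empty member, so members over different
  blocks are incomparable.\<close>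

lemma Union_blocks_in_AMT:
  assumes "partition_on N \<sigma>" "finite N" "\<forall>S\<in>\<sigma>. \<kappa> S \<in> Upsilon S"
  shows "(\<Union>S\<in>\<sigma>. \<kappa> S) \<in> AMT N"
proof -
  have fin: "finite S" and ne: "S \<noteq> {}" if "S \<in> \<sigma>" for S
    using assms(1,2) that by (auto simp: partition_on_def intro: finite_subset)
  have amt: "\<kappa> S \<in> AMT S" and nonempty: "{} \<notin> \<kappa> S" if "S \<in> \<sigma>" for S
    using assms(3) that Upsilon_nonempty[OF fin ne] empty_notin_Upsilon[OF fin ne] by blast+
  have "\<not> A \<subset> B" if "S \<in> \<sigma>" "T \<in> \<sigma>" "A \<in> \<kappa> S" "B \<in> \<kappa> T" for A B S T
  proof (cases "S = T")
    case True
    then show ?thesis using AMT_antichainD[OF amt[OF that(1)]] that by blast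
  next
    case False
    then have "S \<inter> T = {}" using assms(1) that by (auto simp: partition_on_def disjoint_def)
    moreover have "A \<subseteq> S" "B \<subseteq> T" "A \<noteq> {}"
      using AMT_subsetD[OF amt] nonempty that by blast+
    ultimately show ?thesis by blast
  qed
  moreover have "A \<subseteq> N" if "S \<in> \<sigma>" "A \<in> \<kappa> S" for S A
    using AMT_subsetD[OF amt] assms(1) that unfolding partition_on_def by blast
  ultimately show ?thesis by (intro AMT_I) blast+
qed

lemma amt_Join_blocks:
  assumes part: "partition_on N \<sigma>" "finite N" and "\<sigma> \<noteq> {}"
    and \<kappa>: "\<forall>S\<in>\<sigma>. \<kappa> S \<in> Upsilon S"
  shows "amt_Join \<kappa> \<sigma> = (\<Union>S\<in>\<sigma>. \<kappa> S)"
  unfolding amt_Join_def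
proof (rule amt_iter_eqI[where P = "\<lambda>J z. z = (\<Union>S\<in>J. \<kappa> S)"])
  fix T J z
  assume *: "T \<in> \<sigma>" "J \<subseteq> \<sigma>" "z = (\<Union>S\<in>J. \<kappa> S)"
  have "(\<Union>S\<in>insert T J. \<kappa> S) \<in> AMT N"
    by (rule AMT_mono[OF Union_blocks_in_AMT[OF part \<kappa>]]) (use * in blast)
  from max_sets_antichain[OF this]
  show "amt_join (\<kappa> T) z = (\<Union>S\<in>insert T J. \<kappa> S)"
    by (simp add: amt_join_def *(3))
qed (use assms finite_elements in auto)

text \<open>When \<open>sp \<alpha>\<close> and \<open>sp \<beta>\<close> are disjoint, \<open>A \<inter> B\<close> vanishes and nothing is removed from \<open>A\<close> or
  \<open>B\<close>. The sets \<open>A \<union> B\<close> again form an antichain, because both parts are recovered by intersecting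
  with \<open>S\<close> and \<open>T\<close>.\<close>

lemma ext_prod_disjoint:
  assumes "\<alpha> \<in> AMT S" "\<beta> \<in> AMT T" "S \<inter> T = {}"
  shows "ext_prod \<alpha> \<beta> = {X. X \<subseteq> S \<union> T \<and> X \<inter> S \<in> \<alpha> \<and> X \<inter> T \<in> \<beta>}" (is "_ = ?P")
proof -
  have union: "(A - sp \<beta>) \<union> (B - sp \<alpha>) \<union> (A \<inter> B) = A \<union> B"
    and parts: "(A \<union> B) \<inter> S = A" "(A \<union> B) \<inter> T = B" "A \<union> B \<subseteq> S \<union> T"
    if "A \<in> \<alpha>" "B \<in> \<beta>" for A B
  proof -
    have "A \<subseteq> S" "B \<subseteq> T" "sp \<alpha> \<subseteq> S" "sp \<beta> \<subseteq> T"
      using assms(1,2) that unfolding AMT_def sp_def by blast+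
    then show "(A - sp \<beta>) \<union> (B - sp \<alpha>) \<union> (A \<inter> B) = A \<union> B"
      "(A \<union> B) \<inter> S = A" "(A \<union> B) \<inter> T = B" "A \<union> B \<subseteq> S \<union> T"
      using assms(3) by blast+
  qed
  have "{(A - sp \<beta>) \<union> (B - sp \<alpha>) \<union> (A \<inter> B) | A B. A \<in> \<alpha> \<and> B \<in> \<beta>} = {A \<union> B | A B. A \<in> \<alpha> \<and> B \<in> \<beta>}"
    using union by metis
  also have "\<dots> = ?P"
  proof
    show "{A \<union> B | A B. A \<in> \<alpha> \<and> B \<in> \<beta>} \<subseteq> ?P"
    proof clarify
      fix A B assume AB: "A \<in> \<alpha>" "B \<in> \<beta>"
      show "A \<union> B \<subseteq> S \<union> T \<and> (A \<union> B) \<inter> S \<in> \<alpha> \<and> (A \<union> B) \<inter> T \<in> \<beta>"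
        unfolding parts(1,2)[OF AB] using AB parts(3)[OF AB] by (intro conjI)
    qed
    show "?P \<subseteq> {A \<union> B | A B. A \<in> \<alpha> \<and> B \<in> \<beta>}"
    proof
      fix X assume X: "X \<in> ?P"
      then have "X = (X \<inter> S) \<union> (X \<inter> T)" by blast
      then show "X \<in> {A \<union> B | A B. A \<in> \<alpha> \<and> B \<in> \<beta>}" using X by blast
    qed
  qed
  finally have "ext_prod \<alpha> \<beta> = max_sets ?P" unfolding ext_prod_def by simp
  moreover have "?P \<in> AMT (S \<union> T)"
  proof -
    have "X = Y" if "X \<in> ?P" "Y \<in> ?P" "X \<subseteq> Y" for X Y
    proof -
      have "X \<inter> S \<in> \<alpha>" "Y \<inter> S \<in> \<alpha>" "X \<inter> T \<in> \<beta>" "Y \<inter> T \<in> \<beta>" and sub: "X \<subseteq> S \<union> T" "Y \<subseteq> S \<union> T"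
        using that by auto
      moreover have "X \<inter> S \<subseteq> Y \<inter> S" "X \<inter> T \<subseteq> Y \<inter> T"
        using that(3) by auto
      ultimately have "X \<inter> S = Y \<inter> S" "X \<inter> T = Y \<inter> T"
        using AMT_antichainD assms(1,2) by metis+
      then show ?thesis using sub by blast
    qed
    then show ?thesis by (intro AMT_I) simp_all
  qed
  then have "max_sets ?P = ?P" by (rule max_sets_antichain)
  ultimately show ?thesis by simp
qed

text \<open>Comparable sets in the family have comparable, hence equal, traces on every block, and a subset
  of \<open>\<Union>J\<close> is the union of its traces.\<close>

lemma blockwise_members_in_AMT:
  assumes "\<And>S. S \<in> J \<Longrightarrow> \<kappa> S \<in> AMT S"
  shows "{X. X \<subseteq> \<Union>J \<and> (\<forall>S\<in>J. X \<inter> S \<in> \<kappa> S)} \<in> AMT (\<Union>J)"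
proof -
  have "X = Y"
    if X: "X \<subseteq> \<Union>J" "\<forall>S\<in>J. X \<inter> S \<in> \<kappa> S" and Y: "Y \<subseteq> \<Union>J" "\<forall>S\<in>J. Y \<inter> S \<in> \<kappa> S" and "X \<subseteq> Y" for X Y
  proof -
    have "X \<inter> S = Y \<inter> S" if "S \<in> J" for S
      using AMT_antichainD[OF assms[OF that]] X(2) Y(2) \<open>X \<subseteq> Y\<close> that by blast
    then have "(\<Union>S\<in>J. X \<inter> S) = (\<Union>S\<in>J. Y \<inter> S)" by simp
    moreover have "X = (\<Union>S\<in>J. X \<inter> S)" using X(1) by blast
    moreover have "Y = (\<Union>S\<in>J. Y \<inter> S)" using Y(1) by blast
    ultimately show ?thesis by simp
  qed
  then show ?thesis by (intro AMT_I) simp_all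
qed

lemma ext_Prod_blocks:
  assumes "finite \<sigma>" "disjoint \<sigma>" "\<forall>S\<in>\<sigma>. \<kappa> S \<in> AMT S"
  shows "ext_Prod \<kappa> \<sigma> = {X. X \<subseteq> \<Union>\<sigma> \<and> (\<forall>S\<in>\<sigma>. X \<inter> S \<in> \<kappa> S)}"
proof (cases "\<sigma> = {}")
  case True
  then show ?thesis by (auto simp: ext_Prod_def amt_iter_empty)
next
  case False
  let ?P = "\<lambda>J. {X. X \<subseteq> \<Union>J \<and> (\<forall>S\<in>J. X \<inter> S \<in> \<kappa> S)}"
  show ?thesis
    unfolding ext_Prod_def
  proof (rule amt_iter_eqI[where P = "\<lambda>J z. z = ?P J"])
    fix T assume "T \<in> \<sigma>"
    then have "\<kappa> T \<subseteq> Pow T" using assms(3) unfolding AMT_def by blast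
    then show "\<kappa> T = ?P {T}" by (auto simp: Int_absorb2)
  next
    fix T J z
    assume *: "T \<in> \<sigma>" "J \<subseteq> \<sigma>" "T \<notin> J" and z: "z = ?P J"
    have disj: "T \<inter> \<Union>J = {}"
      using disjointD[OF assms(2) *(1)] *(2,3) by blast
    have "z \<in> AMT (\<Union>J)"
      unfolding z by (rule blockwise_members_in_AMT) (use assms(3) * in blast)
    then have "ext_prod (\<kappa> T) z = {X. X \<subseteq> T \<union> \<Union>J \<and> X \<inter> T \<in> \<kappa> T \<and> X \<inter> \<Union>J \<in> z}"
      by (rule ext_prod_disjoint[OF bspec[OF assms(3) *(1)] _ disj])
    moreover have "X \<inter> \<Union>J \<in> z \<longleftrightarrow> (\<forall>S\<in>J. X \<inter> S \<in> \<kappa> S)" for X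
    proof -
      have "X \<inter> \<Union>J \<inter> S = X \<inter> S" if "S \<in> J" for S using that by blast
      then show ?thesis unfolding z by auto
    qed
    ultimately show "ext_prod (\<kappa> T) z = ?P (insert T J)" by auto
  qed (use assms False in auto)
qed

section \<open>Intervals as fibres of the trace map\<close>

text \<open>To enlarge \<open>X\<close> to a member of the product one picks for every block a member of \<open>\<kappa> S\<close> above
  the trace of \<open>X\<close> and takes the union of the picks; disjointness of the blocks makes the traces of
  that union equal to the picks.\<close>

lemma amt_le_ext_Prod_iff:
  assumes "finite \<sigma>" "disjoint \<sigma>" "\<forall>S\<in>\<sigma>. \<kappa> S \<in> AMT S" "sp \<chi> \<subseteq> \<Union>\<sigma>"
  shows "amt_le \<chi> (ext_Prod \<kappa> \<sigma>) \<longleftrightarrow> (\<forall>S\<in>\<sigma>. amt_le (traces S \<chi>) (\<kappa> S))"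
proof
  assume le: "amt_le \<chi> (ext_Prod \<kappa> \<sigma>)"
  show "\<forall>S\<in>\<sigma>. amt_le (traces S \<chi>) (\<kappa> S)"
    unfolding amt_le_def traces_def
  proof clarify
    fix S X assume S: "S \<in> \<sigma>" and X: "X \<in> \<chi>"
    obtain Y where "Y \<in> ext_Prod \<kappa> \<sigma>" "X \<subseteq> Y"
      using le X unfolding amt_le_def by blast
    then have "Y \<inter> S \<in> \<kappa> S" "X \<inter> S \<subseteq> Y \<inter> S"
      unfolding ext_Prod_blocks[OF assms(1-3)] using S by auto
    then show "\<exists>B\<in>\<kappa> S. X \<inter> S \<subseteq> B" by blast
  qed
next
  assume le: "\<forall>S\<in>\<sigma>. amt_le (traces S \<chi>) (\<kappa> S)"
  show "amt_le \<chi> (ext_Prod \<kappa> \<sigma>)"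
    unfolding amt_le_def
  proof
    fix X assume X: "X \<in> \<chi>"
    have "\<forall>S\<in>\<sigma>. \<exists>B. B \<in> \<kappa> S \<and> X \<inter> S \<subseteq> B"
      using le X unfolding amt_le_def traces_def by blast
    then obtain f where f: "\<And>S. S \<in> \<sigma> \<Longrightarrow> f S \<in> \<kappa> S" "\<And>S. S \<in> \<sigma> \<Longrightarrow> X \<inter> S \<subseteq> f S"
      by metis
    have sub: "f S \<subseteq> S" if "S \<in> \<sigma>" for S
      by (rule AMT_subsetD[OF bspec[OF assms(3) that] f(1)[OF that]])
    define Y where "Y = (\<Union>S\<in>\<sigma>. f S)"
    have "Y \<inter> S = f S" if "S \<in> \<sigma>" for S
    proof
      show "f S \<subseteq> Y \<inter> S" using sub that unfolding Y_def by blast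
      show "Y \<inter> S \<subseteq> f S"
      proof
        fix y assume "y \<in> Y \<inter> S"
        then obtain T where T: "T \<in> \<sigma>" "y \<in> f T" "y \<in> S" unfolding Y_def by blast
        then have "T = S" using sub[OF T(1)] disjointD[OF assms(2) T(1) that] by blast
        then show "y \<in> f S" using T by simp
      qed
    qed
    moreover have "Y \<subseteq> \<Union>\<sigma>" using sub unfolding Y_def by blast
    ultimately have "Y \<in> ext_Prod \<kappa> \<sigma>"
      unfolding ext_Prod_blocks[OF assms(1-3)] using f(1) by simp
    moreover have "X \<subseteq> Y"
      using X assms(4) f(2) unfolding Y_def sp_def by blast
    ultimately show "\<exists>B\<in>ext_Prod \<kappa> \<sigma>. X \<subseteq> B" by blast
  qed
qed

lemma Union_blocks_amt_le_iff:
  assumes "\<And>S. S \<in> \<sigma> \<Longrightarrow> \<kappa> S \<subseteq> Pow S"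
  shows "amt_le (\<Union>S\<in>\<sigma>. \<kappa> S) \<chi> \<longleftrightarrow> (\<forall>S\<in>\<sigma>. amt_le (\<kappa> S) (traces S \<chi>))"
proof -
  have "A \<subseteq> X \<longleftrightarrow> A \<subseteq> X \<inter> S" if "S \<in> \<sigma>" "A \<in> \<kappa> S" for A S X
    using assms that by blast
  then show ?thesis
    unfolding amt_le_def traces_def by auto
qed

lemma amt_interval_blocks_iff:
  assumes part: "partition_on N \<sigma>" "finite N" and ne: "\<sigma> \<noteq> {}"
    and \<kappa>: "\<forall>S\<in>\<sigma>. \<kappa> S \<in> Upsilon S"
  shows "\<chi> \<in> amt_interval N (amt_Join \<kappa> \<sigma>) (ext_Prod \<kappa> \<sigma>) \<longleftrightarrow>
    \<chi> \<in> AMT N \<and> (\<forall>S\<in>\<sigma>. max_sets (traces S \<chi>) = \<kappa> S)"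
proof (cases "\<chi> \<in> AMT N")
  case True
  have fin: "finite (traces S \<chi>)" for S
    using finite_AMT[OF part(2) True] by (simp add: traces_def)
  have disj: "disjoint \<sigma>" "\<Union>\<sigma> = N" "finite \<sigma>"
    using part finite_elements unfolding partition_on_def by auto
  have sp: "sp \<chi> \<subseteq> \<Union>\<sigma>"
    using True disj(2) unfolding AMT_def sp_def by blast
  have amt: "\<forall>S\<in>\<sigma>. \<kappa> S \<in> AMT S"
    using \<kappa> unfolding Upsilon_def amt_interval_def by blast
  have eq: "max_sets (traces S \<chi>) = \<kappa> S \<longleftrightarrow>
      amt_le (\<kappa> S) (traces S \<chi>) \<and> amt_le (traces S \<chi>) (\<kappa> S)" if "S \<in> \<sigma>" for S
  proof -
    have "max_sets (traces S \<chi>) \<in> AMT S"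
      by (rule max_sets_in_AMT) (auto simp: traces_def)
    then have "max_sets (traces S \<chi>) = \<kappa> S \<longleftrightarrow>
        amt_le (\<kappa> S) (max_sets (traces S \<chi>)) \<and> amt_le (max_sets (traces S \<chi>)) (\<kappa> S)"
      using amt_le_antisym[OF bspec[OF amt that]] amt_le_refl by auto
    then show ?thesis
      using amt_le_max_sets_iff[OF fin] max_sets_amt_le_iff[OF fin] by simp
  qed
  have "amt_le (amt_Join \<kappa> \<sigma>) \<chi> \<longleftrightarrow> (\<forall>S\<in>\<sigma>. amt_le (\<kappa> S) (traces S \<chi>))"
    unfolding amt_Join_blocks[OF part ne \<kappa>]
    by (rule Union_blocks_amt_le_iff) (use AMT_subsetD[OF bspec[OF amt]] in blast)
  moreover have "amt_le \<chi> (ext_Prod \<kappa> \<sigma>) \<longleftrightarrow> (\<forall>S\<in>\<sigma>. amt_le (traces S \<chi>) (\<kappa> S))"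
    by (rule amt_le_ext_Prod_iff[OF disj(3,1) amt sp])
  ultimately show ?thesis
    using True eq unfolding amt_interval_def by auto
qed (simp add: amt_interval_def)

text \<open>The union is the lower end itself, so it only has to lie below the product. Its traces on a block
  \<open>S\<close> are members of \<open>\<kappa> S\<close> or empty, and \<open>\<kappa> S\<close> has a member above the empty set because it spans
  the nonempty \<open>S\<close>.\<close>

lemma Union_blocks_in_interval:
  assumes part: "partition_on N \<sigma>" "finite N" and ne: "\<sigma> \<noteq> {}"
    and \<kappa>: "\<forall>S\<in>\<sigma>. \<kappa> S \<in> Upsilon S"
  shows "(\<Union>S\<in>\<sigma>. \<kappa> S) \<in> amt_interval N (amt_Join \<kappa> \<sigma>) (ext_Prod \<kappa> \<sigma>)"
proof -
  have amt: "\<forall>S\<in>\<sigma>. \<kappa> S \<in> AMT S"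
    using \<kappa> unfolding Upsilon_def amt_interval_def by blast
  have disj: "disjoint \<sigma>" "\<Union>\<sigma> = N" "finite \<sigma>"
    using part finite_elements unfolding partition_on_def by auto
  have union: "(\<Union>S\<in>\<sigma>. \<kappa> S) \<in> AMT N"
    by (rule Union_blocks_in_AMT[OF part \<kappa>])
  have "amt_le (traces S (\<Union>T\<in>\<sigma>. \<kappa> T)) (\<kappa> S)" if S: "S \<in> \<sigma>" for S
    unfolding amt_le_def traces_def
  proof clarify
    fix T A assume T: "T \<in> \<sigma>" "A \<in> \<kappa> T"
    show "\<exists>B\<in>\<kappa> S. A \<inter> S \<subseteq> B"
    proof (cases "T = S")
      case True
      then show ?thesis using T by blast
    next
      case False
      have "A \<subseteq> T" using AMT_subsetD[OF bspec[OF amt T(1)] T(2)] .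
      then have "A \<inter> S = {}"
        using disjointD[OF disj(1) T(1) S False] by blast
      moreover have "S \<noteq> {}" "finite S"
        using part S by (auto simp: partition_on_def intro: finite_subset)
      then have "\<kappa> S \<noteq> {}"
        using \<kappa> S Upsilon_nonempty[of S] unfolding sp_def by fastforce
      ultimately show ?thesis by auto
    qed
  qed
  moreover have "sp (\<Union>S\<in>\<sigma>. \<kappa> S) \<subseteq> \<Union>\<sigma>"
    using union disj(2) unfolding AMT_def sp_def by blast
  ultimately have "amt_le (\<Union>S\<in>\<sigma>. \<kappa> S) (ext_Prod \<kappa> \<sigma>)"
    using amt_le_ext_Prod_iff[OF disj(3,1) amt] by blast
  then show ?thesis
    using union by (simp add: amt_interval_def amt_Join_blocks[OF part ne \<kappa>] amt_le_refl)
qed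

lemma sp_eq_if_traces_in_Upsilon:
  assumes "partition_on N \<sigma>" "finite N" "\<chi> \<in> AMT N"
    and "\<And>S. S \<in> \<sigma> \<Longrightarrow> max_sets (traces S \<chi>) \<in> Upsilon S"
  shows "sp \<chi> = N"
proof
  show "sp \<chi> \<subseteq> N" using assms(3) unfolding AMT_def sp_def by blast
  have "S \<subseteq> sp \<chi>" if S: "S \<in> \<sigma>" for S
  proof -
    have "S \<noteq> {}" "finite S"
      using assms(1,2) S by (auto simp: partition_on_def intro: finite_subset)
    then have "sp (max_sets (traces S \<chi>)) = S"
      using assms(4)[OF S] Upsilon_nonempty by blast
    then show ?thesis unfolding sp_def max_sets_def traces_def by blast
  qed
  then show "N \<subseteq> sp \<chi>" using assms(1) unfolding partition_on_def by blast
qed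

theorem theorem3:
  fixes N :: "nat set" and \<sigma> :: "nat set set"
  assumes "finite N" and "0 \<notin> N" and "partition_on N \<sigma>"
  shows "partition_on (Upsilon N)
    {amt_interval N (amt_Join \<kappa> \<sigma>) (ext_Prod \<kappa> \<sigma>) | \<kappa> :: nat set \<Rightarrow> nat set set.
       \<forall>S\<in>\<sigma>. \<kappa> S \<in> Upsilon S}"
proof (cases "\<sigma> = {}")
  case True
  \<comment> \<open>The empty family has join and product \<open>{{}}\<close>, which are the ends of the interval \<open>Upsilon {}\<close>.\<close>
  then have N: "N = {}" using assms(3) by (simp add: partition_on_def)
  have "amt_interval {} {{}} {{}} = Upsilon {}"
    by (simp add: Upsilon_def alpha_empty omega_def)
  then show ?thesis
    by (simp add: True N amt_Join_def ext_Prod_def amt_iter_empty Upsilon_empty partition_on_def)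
next
  case False
  note iff = amt_interval_blocks_iff[OF assms(3,1) False]
  let ?I = "\<lambda>\<kappa>. amt_interval N (amt_Join \<kappa> \<sigma>) (ext_Prod \<kappa> \<sigma>)"
  let ?K = "{\<kappa> :: nat set \<Rightarrow> nat set set. \<forall>S\<in>\<sigma>. \<kappa> S \<in> Upsilon S}"
  have block: "finite S" "S \<noteq> {}" "S \<subseteq> N" if "S \<in> \<sigma>" for S
    using assms that by (auto simp: partition_on_def intro: finite_subset)
  have "N \<noteq> {}" using assms(3) False block by blast
  note Upsilon_N = Upsilon_nonempty[OF assms(1) this]
  have cover: "(\<Union>\<kappa>\<in>?K. ?I \<kappa>) = Upsilon N"
  proof
    show "(\<Union>\<kappa>\<in>?K. ?I \<kappa>) \<subseteq> Upsilon N"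
    proof clarify
      fix \<kappa> \<chi> assume \<kappa>: "\<forall>S\<in>\<sigma>. \<kappa> S \<in> Upsilon S" and "\<chi> \<in> ?I \<kappa>"
      then have \<chi>: "\<chi> \<in> AMT N" "\<forall>S\<in>\<sigma>. max_sets (traces S \<chi>) = \<kappa> S"
        using iff[OF \<kappa>] by blast+
      then have "sp \<chi> = N"
        using sp_eq_if_traces_in_Upsilon[OF assms(3,1)] \<kappa> by simp
      then show "\<chi> \<in> Upsilon N" using \<chi> Upsilon_N by blast
    qed
    show "Upsilon N \<subseteq> (\<Union>\<kappa>\<in>?K. ?I \<kappa>)"
    proof
      fix \<chi> assume "\<chi> \<in> Upsilon N"
      then have \<chi>: "\<chi> \<in> AMT N" "sp \<chi> = N" using Upsilon_N by blast+
      have \<kappa>: "\<forall>S\<in>\<sigma>. max_sets (traces S \<chi>) \<in> Upsilon S"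
        using max_traces_in_Upsilon[OF assms(1) \<chi>(1)] block \<chi>(2) by simp
      have "\<chi> \<in> ?I (\<lambda>S. max_sets (traces S \<chi>))"
        using iff[OF \<kappa>] \<chi>(1) by simp
      then show "\<chi> \<in> (\<Union>\<kappa>\<in>?K. ?I \<kappa>)"
        using \<kappa> by blast
    qed
  qed
  have same: "?I \<kappa> = ?I \<kappa>'"
    if "\<kappa> \<in> ?K" "\<kappa>' \<in> ?K" "\<chi> \<in> ?I \<kappa>" "\<chi> \<in> ?I \<kappa>'" for \<kappa> \<kappa>' \<chi>
  proof -
    have K: "\<forall>S\<in>\<sigma>. \<kappa> S \<in> Upsilon S" "\<forall>S\<in>\<sigma>. \<kappa>' S \<in> Upsilon S" using that by auto
    have "\<forall>S\<in>\<sigma>. \<kappa> S = \<kappa>' S"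
      using that(3,4) iff[OF K(1)] iff[OF K(2)] by simp
    then show ?thesis
      using iff[OF K(1)] iff[OF K(2)] by auto
  qed
  have nonempty: "?I \<kappa> \<noteq> {}" if "\<kappa> \<in> ?K" for \<kappa>
    using Union_blocks_in_interval[OF assms(3,1) False] that by blast
  have "partition_on (Upsilon N) (?I ` ?K)"
  proof (rule partition_onI)
    show "\<Union>(?I ` ?K) = Upsilon N" using cover by simp
    show "disjnt p q" if "p \<in> ?I ` ?K" "q \<in> ?I ` ?K" "p \<noteq> q" for p q
      using that same unfolding disjnt_def by blast
    show "{} \<notin> ?I ` ?K"
      using nonempty by blast
  qed
  moreover have "?I ` ?K = {?I \<kappa> | \<kappa>. \<forall>S\<in>\<sigma>. \<kappa> S \<in> Upsilon S}" by blast
  ultimately show ?thesis by simp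
qed

end
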